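(* Fix $a\in\mathbb{Z}$ and define $(u_n)_{n\geq 0}$ by $u_0=0$, $u_1=1$, $u_{n+2}=au_{n+1}-u_n$. Fix $n\in\mathbb{Z}_{>0}$ with $u_n\neq 0$. Let $s\in\mathbb{Z}\setminus\{0\}$ satisfy $s\mid u_n$, and let $t\in\mathbb{Z}$ be odd. Then, for every residue class $c\pmod{s}$, there are infinitely many positive odd integers $k$ such that $$k\equiv t\pmod{u_n^2}\quad\text{and}\quad\frac{u_{nk}/u_n-t}{u_n^2}\equiv c\pmod{s}.$$
   Context: All congruences are between integers (in particular, the second congruence asserts that $(u_{nk}/u_n-t)/u_n^2$ is an integer). *)

theory Defs
  imports Complex_Main "HOL-Number_Theory.Cong"
begin

fun u :: "int \<Rightarrow> nat \<Rightarrow> int" where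
  "u a 0 = 0"
| "u a (Suc 0) = 1"
| "u a (Suc (Suc n)) = a * u a (Suc n) - u a n"

end

theory Submission
  imports Defs "HOL-Library.Infinite_Set"
begin

text \<open>
  Put \<open>U = u\<^sub>n\<close> and \<open>D = a\<^sup>2 - 4\<close>. Expanding \<open>u\<^sub>n\<^sub>k / U\<close> for odd \<open>k = 2m + 1\<close> in powers of \<open>D U\<^sup>2\<close>
  gives \<open>u\<^sub>n\<^sub>k / U \<equiv> k + D Q(m) U\<^sup>2\<close> modulo \<open>U\<^sup>4\<close>, where \<open>Q(m) = 1\<^sup>2 + \<dots> + m\<^sup>2\<close>.
  Hence for \<open>k = t + U\<^sup>2 l\<close> the quotient in question is \<open>l + D Q(m)\<close> modulo \<open>U\<close>.
  Changing \<open>l\<close> moves \<open>m\<close> by \<open>h = U\<^sup>2 l / 2\<close>, which does not affect \<open>D Q(m)\<close> modulo \<open>U\<close>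
  (at the prime 2 this uses that \<open>D U\<close> is divisible by 4 when \<open>U\<close> is even),
  so the quotient runs through all residue classes as \<open>l\<close> does.
\<close>

section \<open>Square pyramidal numbers\<close>

text \<open>The closed form of Q(m), defined on all integers because \<open>m0\<close> in the final
  proof may be negative.\<close>

definition pyramidal :: "int \<Rightarrow> int" where
  "pyramidal m = m * (m + 1) * (2 * m + 1) div 6"

lemma six_pyramidal: "6 * pyramidal m = m * (m + 1) * (2 * m + 1)"
proof -
  have "2 dvd m * (m + 1) * (2 * m + 1)" by auto
  moreover have "3 dvd m * (m + 1) * (2 * m + 1)"
  proof -
    have "3 dvd m \<or> 3 dvd m + 1 \<or> 3 dvd 2 * m + 1" by presburger
    then show ?thesis by (auto intro: dvd_mult dvd_mult2)
  qed
  moreover have "coprime (2::int) 3" by simp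
  ultimately have "2 * 3 dvd m * (m + 1) * (2 * m + 1)" by (intro divides_mult)
  then show ?thesis by (simp add: pyramidal_def)
qed

text \<open>This isolates \<open>pyramidal h\<close>, the only part of the increment that is not
  visibly a multiple of \<open>h\<close>.\<close>

lemma pyramidal_add:
  "pyramidal (m + h) = pyramidal m + h * (m\<^sup>2 + h * m + m) + pyramidal h"
proof -
  have "6 * pyramidal (m + h) = 6 * (pyramidal m + h * (m\<^sup>2 + h * m + m) + pyramidal h)"
    unfolding distrib_left six_pyramidal
    by (simp add: algebra_simps power2_eq_square)
  then show ?thesis by simp
qed

lemma pyramidal_second_difference:
  "pyramidal (m + 2) = 2 * pyramidal (m + 1) + (2 * m + 3) - pyramidal m"
proof -
  have "6 * pyramidal (m + 2) = 6 * (2 * pyramidal (m + 1) + (2 * m + 3) - pyramidal m)"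
    using six_pyramidal[of "m + 2"] six_pyramidal[of "m + 1"] six_pyramidal[of m]
    by (simp add: algebra_simps)
  then show ?thesis by simp
qed

section \<open>Addition formulas and odd multiples of the index\<close>

lemma u_add_Suc: "u a (Suc (x + n)) = u a (Suc x) * u a (Suc n) - u a x * u a n"
proof (induction x rule: induct_nat_012)
  case (ge2 x)
  have "u a (Suc (Suc (Suc x) + n)) = a * u a (Suc (Suc x + n)) - u a (Suc (x + n))" by simp
  then show ?case unfolding ge2 by (simp add: algebra_simps)
qed auto

text \<open>The second coefficient plays the role of -u_(n-1), in a form that also makes sense for
  \<open>n = 0\<close>.\<close>

lemma u_add: "u a (x + n) = u a n * u a (Suc x) + (u a (Suc n) - a * u a n) * u a x"
proof (induction x rule: induct_nat_012)
  case (ge2 x)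
  have "u a (Suc (Suc x) + n) = a * u a (Suc x + n) - u a (x + n)" by simp
  then show ?case unfolding ge2 by (simp add: algebra_simps)
qed auto

lemma u_cassini: "(u a (Suc n))\<^sup>2 - a * u a (Suc n) * u a n + (u a n)\<^sup>2 = 1"
  by (induction n) (auto simp: algebra_simps power2_eq_square)

text \<open>Steps of length \<open>n\<close> obey a recurrence of the same shape, with
  \<open>a\<close> replaced by the companion value V_n = x^n + x^(-n), where x is a root of X^2 - a
  X + 1.\<close>

lemma u_add_double:
  "u a (x + 2 * n) = (2 * u a (Suc n) - a * u a n) * u a (x + n) - u a x"
proof -
  have "u a (x + 2 * n) = u a ((x + n) + n)" by (simp add: mult_2 add.assoc)
  also have "\<dots> = (2 * u a (Suc n) - a * u a n) * u a (x + n)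
      - u a x * ((u a (Suc n))\<^sup>2 - a * u a (Suc n) * u a n + (u a n)\<^sup>2)"
    unfolding u_add[of a "x + n" n] u_add_Suc unfolding u_add[of a x n]
    by (simp add: algebra_simps power2_eq_square)
  finally show ?thesis by (simp add: u_cassini)
qed

lemma companion_square:
  "(2 * u a (Suc n) - a * u a n)\<^sup>2 = (a\<^sup>2 - 4) * (u a n)\<^sup>2 + 4"
proof -
  have "(2 * u a (Suc n) - a * u a n)\<^sup>2 - (a\<^sup>2 - 4) * (u a n)\<^sup>2
      = 4 * ((u a (Suc n))\<^sup>2 - a * u a (Suc n) * u a n + (u a n)\<^sup>2)"
    by (simp add: algebra_simps power2_eq_square)
  then show ?thesis by (simp add: u_cassini)
qed

text \<open>Doubling the step replaces V_n by V_n^2 - 2, which \<open>companion_square\<close> turns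
  into a polynomial in D U^2. This is what makes an expansion in U^2 possible.\<close>

lemma u_add_quadruple:
  "u a (x + 4 * n) = ((a\<^sup>2 - 4) * (u a n)\<^sup>2 + 2) * u a (x + 2 * n) - u a x"
proof -
  let ?V = "2 * u a (Suc n) - a * u a n"
  have 1: "u a (x + 4 * n) = ?V * u a (x + 3 * n) - u a (x + 2 * n)"
    using u_add_double[of a "x + 2 * n" n] by (simp add: algebra_simps)
  have 2: "u a (x + 3 * n) = ?V * u a (x + 2 * n) - u a (x + n)"
    using u_add_double[of a "x + n" n] by (simp add: add.assoc numeral_eq_Suc)
  have 3: "?V * u a (x + n) = u a (x + 2 * n) + u a x"
    using u_add_double[of a x n] by simp
  have "u a (x + 4 * n) = ?V\<^sup>2 * u a (x + 2 * n) - ?V * u a (x + n) - u a (x + 2 * n)"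
    unfolding 1 2 by (simp only: algebra_simps power2_eq_square)
  then show ?thesis
    unfolding 3 companion_square by (simp add: algebra_simps)
qed

lemma u_odd_multiple_expansion:
  "\<exists>r. u a (n * (2 * m + 1)) = u a n *
    (int (2 * m + 1) + pyramidal (int m) * (a\<^sup>2 - 4) * (u a n)\<^sup>2 + (u a n)^4 * r)"
proof -
  define U where "U = u a n"
  define D where "D = a\<^sup>2 - 4"
  define W where "W m r = int (2 * m + 1) + pyramidal (int m) * D * U\<^sup>2 + U^4 * r" for m r
  \<comment> \<open>The recurrence has order two, so the induction carries two consecutive odd
    multiples.\<close>
  have "\<exists>r r'. u a (n * (2 * m + 1)) = U * W m r \<and> u a (n * (2 * m + 3)) = U * W (Suc m) r'"
  proof (induction m)
    case 0
    have "n * 3 = n + 2 * n" by simp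
    then have "u a (n * 3) = (2 * u a (Suc n) - a * u a n) * u a (2 * n) - U"
      by (simp only: u_add_double U_def flip: mult_2)
    also have "u a (2 * n) = (2 * u a (Suc n) - a * u a n) * U"
      using u_add_double[of a 0 n] by (simp add: U_def)
    finally have "u a (n * 3) = (2 * u a (Suc n) - a * u a n)\<^sup>2 * U - U"
      by (simp add: power2_eq_square)
    then have "u a (n * 3) = U * (3 + D * U\<^sup>2)"
      unfolding companion_square by (simp add: U_def D_def algebra_simps)
    then show ?case
      by (intro exI[of _ 0]) (simp add: W_def pyramidal_def U_def)
  next
    case (Suc m)
    then obtain r r' where r: "u a (n * (2 * m + 1)) = U * W m r"
      and r': "u a (n * (2 * m + 3)) = U * W (Suc m) r'" by blast
    have "u a (n * (2 * m + 5)) = (D * U\<^sup>2 + 2) * u a (n * (2 * m + 3)) - u a (n * (2 * m + 1))"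
    proof -
      have "n * (2 * m + 5) = n * (2 * m + 1) + 4 * n" "n * (2 * m + 3) = n * (2 * m + 1) + 2 * n"
        by (simp_all add: algebra_simps)
      then show ?thesis by (simp only: u_add_quadruple U_def D_def)
    qed
    also have "\<dots> = U * ((D * U\<^sup>2 + 2) * W (Suc m) r' - W m r)"
      unfolding r r' by (simp add: algebra_simps)
    \<comment> \<open>The U^2 terms combine by the second difference of \<open>pyramidal\<close>;
      the product of D U^2 with the U^2 term of \<open>W (Suc m) r'\<close> goes into the new
      remainder.\<close>
    also have "(D * U\<^sup>2 + 2) * W (Suc m) r' - W m r
        = W (Suc (Suc m)) (D\<^sup>2 * pyramidal (int m + 1) + (D * U\<^sup>2 + 2) * r' - r)"
    proof -
      have "pyramidal (int (Suc (Suc m)))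
          = 2 * pyramidal (int m + 1) + (2 * int m + 3) - pyramidal (int m)"
        using pyramidal_second_difference[of "int m"] by (simp add: add.commute)
      moreover have "pyramidal (int (Suc m)) = pyramidal (int m + 1)"
        by (simp add: add.commute)
      ultimately show ?thesis
        unfolding W_def by (simp only:) (simp add: algebra_simps power2_eq_square power4_eq_xxxx)
    qed
    finally have "u a (n * (2 * m + 5))
        = U * W (Suc (Suc m)) (D\<^sup>2 * pyramidal (int m + 1) + (D * U\<^sup>2 + 2) * r' - r)" .
    moreover have "2 * Suc m + 1 = 2 * m + 3" "2 * Suc m + 3 = 2 * m + 5" by simp_all
    ultimately show ?case using r' by metis
  qed
  then show ?thesis by (auto simp: W_def U_def D_def)
qed

section \<open>Divisibility by U\<close>

text \<open>For odd \<open>a\<close> the sequence modulo 2 is 0, 1, 1 repeated, so even values occur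
  only at multiples of 3. There the three-step recurrence preserves divisibility by 4, since 4
  divides a^2 - 1.\<close>

lemma u_even_imp_four_dvd:
  assumes "odd a" "even (u a n)"
  shows "4 dvd u a n"
proof -
  obtain b where b: "a = 2 * b + 1" using assms(1) by (elim oddE)
  have 4: "4 dvd a\<^sup>2 - 1" unfolding b by (simp add: power2_eq_square algebra_simps)
  have step: "u a (Suc (Suc (Suc i))) = (a\<^sup>2 - 1) * u a (Suc i) - a * u a i" for i
    by (simp add: algebra_simps power2_eq_square)
  have *: "4 dvd u a (3 * q) \<and> odd (u a (Suc (3 * q))) \<and> odd (u a (Suc (Suc (3 * q))))" for q
  proof (induction q)
    case 0
    then show ?case using assms(1) by simp
  next
    case (Suc q)
    let ?q = "3 * Suc q"
    have q: "?q = Suc (Suc (Suc (3 * q)))" by simp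
    have dvd: "4 dvd u a ?q"
      unfolding q step using dvd_diff[OF dvd_mult2[OF 4] dvd_mult] Suc by blast
    then have "even (u a ?q)" by presburger
    moreover have "u a (Suc ?q) = a * u a ?q - u a (Suc (Suc (3 * q)))"
      unfolding q by (rule u.simps(3))
    ultimately have "odd (u a (Suc ?q))" using Suc by (metis even_diff even_mult_iff even_add)
    moreover have "u a (Suc (Suc ?q)) = a * u a (Suc ?q) - u a ?q"
      by (rule u.simps(3))
    ultimately show ?case using dvd \<open>even (u a ?q)\<close> assms(1)
      by (metis even_diff even_mult_iff even_add)
  qed
  have "n = 3 * (n div 3) \<or> n = Suc (3 * (n div 3)) \<or> n = Suc (Suc (3 * (n div 3)))"
    by presburger
  then show ?thesis using *[of "n div 3"] assms(2) by metis
qed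

lemma four_dvd_discriminant_mult:
  assumes "even (u a n)"
  shows "4 dvd (a\<^sup>2 - 4) * u a n"
proof (cases "even a")
  case True
  then obtain b where "a = 2 * b" by (elim evenE)
  then have "4 dvd a\<^sup>2 - 4" by (simp add: power2_eq_square)
  then show ?thesis by (rule dvd_mult2)
next
  case False
  then show ?thesis using u_even_imp_four_dvd assms by simp
qed

text \<open>Since D U^2 divides 12 P, the factor 12 has to be removed. The primes 3 and 2 are
  treated separately, giving U | 4 P and U | 3 P, whose difference is P.\<close>

lemma dvd_mult_pyramidal:
  fixes U D h l :: int
  assumes h: "2 * h = U\<^sup>2 * l" and four: "even U \<Longrightarrow> 4 dvd D * U"
  shows "U dvd D * pyramidal h"
proof -
  define P where "P = D * pyramidal h"
  have "12 * P = D * (2 * (6 * pyramidal h))" by (simp add: P_def)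
  also have "\<dots> = D * ((2 * h) * ((h + 1) * (2 * h + 1)))" unfolding six_pyramidal by simp
  also have "\<dots> = D * U\<^sup>2 * (l * ((h + 1) * (2 * h + 1)))" unfolding h by simp
  finally have twelve: "D * U\<^sup>2 dvd 12 * P" by simp
  then have U2: "U\<^sup>2 dvd 12 * P" using dvd_mult_right by blast
  \<comment> \<open>Either 3 is invertible modulo U, or the spare factor U in U^2 absorbs
    it.\<close>
  have "U dvd 4 * P"
  proof (cases "3 dvd U")
    case True
    then have "3 * U dvd U\<^sup>2" by (simp add: power2_eq_square)
    with U2 have "3 * U dvd 3 * (4 * P)" using dvd_trans by fastforce
    then show ?thesis by (subst (asm) dvd_mult_cancel_left) simp
  next
    case False
    then have "coprime U 3"
      using prime_imp_coprime[of 3 U] by (simp add: coprime_commute)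
    moreover have "U dvd 3 * (4 * P)"
      using U2 dvd_mult_left[of U U "12 * P"] by (simp add: power2_eq_square)
    ultimately show ?thesis by (simp only: coprime_dvd_mult_right_iff)
  qed
  \<comment> \<open>For even U the factor 4 is absorbed by D U, and for odd U it is invertible
    modulo U.\<close>
  moreover have "U dvd 3 * P"
  proof (cases "even U")
    case True
    have "4 * U dvd D * U\<^sup>2"
      using mult_dvd_mono[OF four[OF True] dvd_refl[of U]] by (simp add: power2_eq_square mult.assoc)
    with twelve have "4 * U dvd 4 * (3 * P)" using dvd_trans by fastforce
    then show ?thesis by (subst (asm) dvd_mult_cancel_left) simp
  next
    case False
    then have "coprime U 2" by simp
    then have "coprime U (2 * 2)" by (simp only: coprime_mult_right_iff)
    then have "coprime U 4" by simp
    moreover have "U dvd 4 * (3 * P)" using \<open>U dvd 4 * P\<close> by (metis dvd_mult mult.left_commute)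
    ultimately show ?thesis by (simp only: coprime_dvd_mult_right_iff)
  qed
  ultimately have "U dvd 4 * P - 3 * P" by (rule dvd_diff)
  then show ?thesis by (simp add: P_def)
qed

lemma dvd_mult_pyramidal_diff:
  fixes U D h l m :: int
  assumes h: "2 * h = U\<^sup>2 * l" and four: "even U \<Longrightarrow> 4 dvd D * U"
  shows "U dvd D * (pyramidal (m + h) - pyramidal m)"
proof -
  \<comment> \<open>Halving U^2 costs at most one factor 2, so a factor U survives.\<close>
  have "U dvd h"
  proof (cases "even U")
    case True
    then obtain b where "U = 2 * b" by (elim evenE)
    then have "h = U * (b * l)" using h by (simp add: power2_eq_square)
    then show ?thesis by simp
  next
    case False
    then have "coprime U 2" by simp
    moreover have "U dvd 2 * h" unfolding h by (simp add: power2_eq_square)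
    ultimately show ?thesis by (simp add: coprime_dvd_mult_right_iff)
  qed
  moreover have "U dvd D * pyramidal h" using assms by (rule dvd_mult_pyramidal)
  ultimately show ?thesis
    unfolding pyramidal_add by (simp add: distrib_left)
qed

section \<open>Choice of k\<close>

theorem theorem5p6:
  fixes a s t c :: int and n :: nat
  assumes "n > 0"
    and "u a n \<noteq> 0"
    and "s \<noteq> 0"
    and "s dvd u a n"
    and "odd t"
  shows "infinite {k :: nat. k > 0 \<and> odd k \<and> [int k = t] (mod (u a n)\<^sup>2) \<and>
    (\<exists>z :: int. (rat_of_int (u a (n * k)) / rat_of_int (u a n) - rat_of_int t)
                  / (rat_of_int (u a n))\<^sup>2 = rat_of_int z
              \<and> [z = c] (mod s))}"
  unfolding infinite_nat_iff_unbounded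
proof (intro allI)
  fix N :: nat
  define U where "U = u a n"
  define D where "D = a\<^sup>2 - 4"
  have U0: "U \<noteq> 0" and sU: "s dvd U" using assms by (simp_all add: U_def)
  obtain m0 where m0: "t = 2 * m0 + 1" using \<open>odd t\<close> by (elim oddE)
  \<comment> \<open>The residue class modulo \<open>s\<close> that \<open>l\<close> has to
    meet.\<close>
  define e where "e = c - D * pyramidal m0"
  \<comment> \<open>The factor \<open>1 + s\<close> is even when \<open>s\<close> is odd, so that \<open>U\<^sup>2 * l\<close> is always even.\<close>
  define w where "w = e * (1 + s)"
  \<comment> \<open>The absolute values offset negative \<open>w\<close> and \<open>t\<close>, so
    that \<open>k\<close> exceeds \<open>N\<close>. The shift by \<open>2 * s\<^sup>2 * i\<close>
    keeps the parity of \<open>l\<close> and its class modulo \<open>s\<close>, and the square makes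
    it nonnegative for either sign of \<open>s\<close>.\<close>
  define i where "i = int N + \<bar>w\<bar> + \<bar>t\<bar> + 1"
  define l where "l = w + 2 * s\<^sup>2 * i"
  have "even (U\<^sup>2 * l)"
  proof (cases "even U")
    case False
    then have "odd s" using sU dvd_trans by blast
    then show ?thesis by (simp add: l_def w_def)
  qed simp
  then obtain h where h: "2 * h = U\<^sup>2 * l" by (metis evenE)
  have "s\<^sup>2 \<ge> 1" using \<open>s \<noteq> 0\<close> by (simp add: int_one_le_iff_zero_less)
  moreover have "i \<ge> 0" by (simp add: i_def)
  ultimately have "1 * i \<le> s\<^sup>2 * i" by (rule mult_right_mono)
  with \<open>i \<ge> 0\<close> have "l \<ge> w + i" unfolding l_def mult.assoc by linarith
  then have l: "l \<ge> int N + \<bar>t\<bar> + 1"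
    unfolding i_def using abs_ge_minus_self[of w] by linarith
  have "U\<^sup>2 \<ge> 1" using U0 by (simp add: int_one_le_iff_zero_less)
  then have "1 * l \<le> U\<^sup>2 * l" using l by (intro mult_right_mono) auto
  then have big: "t + U\<^sup>2 * l \<ge> int N + 1" using l by linarith
  \<comment> \<open>Here 2 (m0 + h) + 1 = t + U^2 l is positive, so \<open>nat\<close> loses
    nothing.\<close>
  define m where "m = nat (m0 + h)"
  define k where "k = 2 * m + 1"
  have m: "int m = m0 + h" using big h m0 by (simp add: m_def)
  have k: "int k = t + U\<^sup>2 * l" using m h m0 by (simp add: k_def)
  obtain r where r: "u a (n * k) = U * (int k + pyramidal (int m) * D * U\<^sup>2 + U^4 * r)"
    using u_odd_multiple_expansion[of a n m] by (auto simp: k_def U_def D_def)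
  define z where "z = l + D * pyramidal (int m) + U\<^sup>2 * r"
  have "u a (n * k) = U * (t + U\<^sup>2 * z)"
    unfolding r z_def k by (simp add: algebra_simps power2_eq_square power4_eq_xxxx)
  then have z: "(rat_of_int (u a (n * k)) / rat_of_int U - rat_of_int t) / (rat_of_int U)\<^sup>2
      = rat_of_int z"
    using U0 by simp
  have "s dvd D * (pyramidal (m0 + h) - pyramidal m0)"
    using dvd_trans[OF sU dvd_mult_pyramidal_diff[OF h]] four_dvd_discriminant_mult[of a n]
    by (simp add: U_def D_def)
  moreover have "s dvd U\<^sup>2 * r" using sU by (simp add: power2_eq_square)
  moreover have "s dvd s * (e + 2 * s * i)" by simp
  \<comment> \<open>The first summand is \<open>l - e\<close>; the second is the change of D Q
    caused by moving from \<open>m0\<close> to \<open>m\<close>.\<close>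
  moreover have "z - c = s * (e + 2 * s * i) + D * (pyramidal (m0 + h) - pyramidal m0) + U\<^sup>2 * r"
    unfolding z_def l_def w_def m by (simp add: e_def algebra_simps power2_eq_square)
  ultimately have "[z = c] (mod s)" unfolding cong_iff_dvd_diff by (metis dvd_add)
  moreover have "k > N" using big k by linarith
  moreover have "[int k = t] (mod U\<^sup>2)" by (simp add: k cong_iff_dvd_diff)
  ultimately show "\<exists>k>N. k \<in> {k :: nat. k > 0 \<and> odd k \<and> [int k = t] (mod (u a n)\<^sup>2) \<and>
    (\<exists>z :: int. (rat_of_int (u a (n * k)) / rat_of_int (u a n) - rat_of_int t)
                  / (rat_of_int (u a n))\<^sup>2 = rat_of_int z
              \<and> [z = c] (mod s))}"
    using z by (intro exI[of _ k]) (auto simp: k_def U_def)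
qed

end
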